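(* For any $n\ge1$, any nonnegative monotone submodular function $f:2^N\to\mathbb{R}_+$ with $N=\{1,\dots,n\}$, and any $\mathbf{x}\in[0,1]^n$, $$\frac{f^+(\mathbf{x})}{f^{++}(\mathbf{x})}\le\frac{e}{e-1}.$$ Moreover, the bound is asymptotically attained in the following setting. Let $m=m(n)$ be a sequence of positive integers with $m(n)\le n$, $m(n)\to\infty$ and $m(n)=o(n)$ as $n\to\infty$. For each $n$, partition $N=\{1,\dots,n\}$ into $m$ blocks $N=A_1\cup\cdots\cup A_m$ with $|A_r|=\ell=\lfloor n/m\rfloor$ for $1\le r\le m-1$ and $|A_m|=\ell_m=n-(m-1)\ell$. Let $\mathcal{H}_m=A_1\times\cdots\times A_m$ be the family of all $m$-element subsets $H\subseteq N$ obtained by choosing exactly one element from each block, and let $$g_m(S)=\sum_{H\in\mathcal{H}_m}\mathbf{1}\{S\cap H\neq\emptyset\},\qquad S\subseteq N.$$ Let $\mathbf{x}^{\mathrm{id}}=(1/m,\dots,1/m)\in[0,1]^n$. Then, with $f=g_m$, $$\frac{f^+(\mathbf{x}^{\mathrm{id}})}{f^{++}(\mathbf{x}^{\mathrm{id}})}\longrightarrow\frac{e}{e-1}\qquad\text{as } n\to\infty.$$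
   Context: A set function $f:2^N\to\mathbb{R}_+$ is monotone if $f(S)\le f(T)$ for all $S\subseteq T\subseteq N$, and submodular if $f(S)+f(T)\ge f(S\cap T)+f(S\cup T)$ for all $S,T\subseteq N$. For $N=\{1,\dots,n\}$ and $\mathbf{x}\in[0,1]^n$, the concave closure $f^+(\mathbf{x})$ is the maximum of $\sum_{S\subseteq N}u_Sf(S)$ over all $(u_S)_{S\subseteq N}$ with $u_S\ge0$, $\sum_{S\subseteq N}u_S=1$ and $\sum_{S\ni i}u_S=x_i$ for all $i\in N$. The pairwise independent extension $f^{++}(\mathbf{x})$ is the maximum of $\sum_{S\subseteq N}p_Sf(S)$ over all $(p_S)_{S\subseteq N}$ with $p_S\ge0$, $\sum_{S\subseteq N}p_S=1$, $\sum_{S\ni i}p_S=x_i$ for all $i\in N$, and $\sum_{S\supseteq\{i,j\}}p_S=x_ix_j$ for all $i<j$ in $N$. The ratio is considered whenever $f^{++}(\mathbf{x})>0$. The function $g_m$ is a (unit weight) coverage function, hence nonnegative, monotone and submodular. *)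

theory Defs
  imports "HOL-Analysis.Analysis" "HOL-Library.Landau_Symbols"
begin

definition submodular_on :: "'a set \<Rightarrow> ('a set \<Rightarrow> real) \<Rightarrow> bool" where
  "submodular_on N f \<longleftrightarrow>
     (\<forall>S\<in>Pow N. \<forall>T\<in>Pow N. f S + f T \<ge> f (S \<inter> T) + f (S \<union> T))"

definition marginal_weights :: "nat set \<Rightarrow> (nat \<Rightarrow> real) \<Rightarrow> (nat set \<Rightarrow> real) set" where
  "marginal_weights N x =
     {u. (\<forall>S\<in>Pow N. u S \<ge> 0) \<and> (\<Sum>S\<in>Pow N. u S) = 1 \<and>
         (\<forall>i\<in>N. (\<Sum>S | S \<subseteq> N \<and> i \<in> S. u S) = x i)}"

definition pairwise_weights :: "nat set \<Rightarrow> (nat \<Rightarrow> real) \<Rightarrow> (nat set \<Rightarrow> real) set" where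
  "pairwise_weights N x =
     {p \<in> marginal_weights N x.
        \<forall>i\<in>N. \<forall>j\<in>N. i < j \<longrightarrow> (\<Sum>S | S \<subseteq> N \<and> {i, j} \<subseteq> S. p S) = x i * x j}"

text \<open>Both extensions are maxima of linear programs. They are defined as suprema;
  for finite \<open>N\<close> and \<open>x\<close> with values in \<open>[0,1]\<close>, lemmas
  \<open>concave_closure_max\<close> and \<open>pairwise_extension_max\<close> below show that the suprema
  are attained, so that they are indeed the maxima.\<close>

definition concave_closure :: "nat set \<Rightarrow> (nat set \<Rightarrow> real) \<Rightarrow> (nat \<Rightarrow> real) \<Rightarrow> real" where
  "concave_closure N f x = (SUP u\<in>marginal_weights N x. \<Sum>S\<in>Pow N. u S * f S)"

definition pairwise_extension :: "nat set \<Rightarrow> (nat set \<Rightarrow> real) \<Rightarrow> (nat \<Rightarrow> real) \<Rightarrow> real" where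
  "pairwise_extension N f x = (SUP p\<in>pairwise_weights N x. \<Sum>S\<in>Pow N. p S * f S)"

text \<open>\<open>A\<close> is a partition of \<open>{1..n}\<close> into the blocks \<open>A 1, \<dots>, A m\<close>; the last block
  absorbs the remainder of the division of \<open>n\<close> by \<open>m\<close>.\<close>

definition block_partition :: "nat \<Rightarrow> nat \<Rightarrow> (nat \<Rightarrow> nat set) \<Rightarrow> bool" where
  "block_partition n m A \<longleftrightarrow>
     disjoint_family_on A {1..m} \<and> (\<Union>r\<in>{1..m}. A r) = {1..n} \<and>
     (\<forall>r\<in>{1..m-1}. card (A r) = n div m) \<and>
     card (A m) = n - (m - 1) * (n div m)"

definition transversals :: "nat \<Rightarrow> (nat \<Rightarrow> nat set) \<Rightarrow> nat set set" where
  "transversals m A = (\<lambda>h. h ` {1..m}) ` (\<Pi>\<^sub>E r\<in>{1..m}. A r)"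

definition transversal_coverage :: "nat \<Rightarrow> (nat \<Rightarrow> nat set) \<Rightarrow> nat set \<Rightarrow> real" where
  "transversal_coverage m A S = (\<Sum>H\<in>transversals m A. of_bool (S \<inter> H \<noteq> {}))"

lemma product_weights_superset_sum:
  fixes x :: "'a \<Rightarrow> real"
  assumes "finite N" "T \<subseteq> N"
  shows "(\<Sum>S | S \<subseteq> N \<and> T \<subseteq> S. prod x S * (\<Prod>i\<in>N - S. 1 - x i)) = prod x T"
proof -
  define g where "g = (\<lambda>i. if i \<in> T then 0 else 1 - x i)"
  have "(\<Sum>S | S \<subseteq> N \<and> T \<subseteq> S. prod x S * (\<Prod>i\<in>N - S. 1 - x i)) =
        (\<Sum>S\<in>Pow N. prod x S * prod g (N - S))"
  proof (rule sum.mono_neutral_cong_left)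
    show "finite (Pow N)" using assms by simp
    show "\<forall>S\<in>Pow N - {S. S \<subseteq> N \<and> T \<subseteq> S}. prod x S * prod g (N - S) = 0"
    proof
      fix S assume "S \<in> Pow N - {S. S \<subseteq> N \<and> T \<subseteq> S}"
      then obtain i where "i \<in> T" "i \<in> N - S" using assms by auto
      then show "prod x S * prod g (N - S) = 0"
        using assms by (auto simp: g_def intro!: prod_zero)
    qed
    show "prod x S * (\<Prod>i\<in>N - S. 1 - x i) = prod x S * prod g (N - S)"
      if "S \<in> {S. S \<subseteq> N \<and> T \<subseteq> S}" for S
      using that by (auto simp: g_def intro!: prod.cong)
  qed auto
  also have "\<dots> = (\<Prod>i\<in>N. x i + g i)"
    using assms by (simp add: prod_add)
  also have "\<dots> = (\<Prod>i\<in>T. x i)"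
    using assms by (intro prod.mono_neutral_cong_right) (auto simp: g_def)
  finally show ?thesis .
qed

lemma pairwise_weights_nonempty:
  assumes "finite N" "\<And>i. i \<in> N \<Longrightarrow> x i \<in> {0..1}"
  shows "pairwise_weights N x \<noteq> {}"
proof -
  define p where "p = (\<lambda>S. prod x S * (\<Prod>i\<in>N - S. 1 - x i))"
  have "p S \<ge> 0" if "S \<subseteq> N" for S
  proof -
    have "prod x S \<ge> 0" using that assms(2) by (intro prod_nonneg) auto
    moreover have "(\<Prod>i\<in>N - S. 1 - x i) \<ge> 0" using assms(2) by (intro prod_nonneg) auto
    ultimately show ?thesis by (simp add: p_def)
  qed
  moreover have "(\<Sum>S\<in>Pow N. p S) = 1"
    using product_weights_superset_sum[OF assms(1), of "{}" x] by (simp add: p_def Pow_def)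
  moreover have "(\<Sum>S | S \<subseteq> N \<and> i \<in> S. p S) = x i" if "i \<in> N" for i
    using product_weights_superset_sum[OF assms(1), of "{i}" x] that by (simp add: p_def)
  moreover have "(\<Sum>S | S \<subseteq> N \<and> {i, j} \<subseteq> S. p S) = x i * x j"
    if "i \<in> N" "j \<in> N" "i < j" for i j
    using product_weights_superset_sum[OF assms(1), of "{i, j}" x] that by (simp add: p_def)
  ultimately have "p \<in> pairwise_weights N x"
    unfolding pairwise_weights_def marginal_weights_def by auto
  then show ?thesis by blast
qed

lemma linear_program_attains_sup:
  fixes f :: "nat set \<Rightarrow> real" and c :: "'k \<Rightarrow> real" and F :: "'k \<Rightarrow> nat set set"
  assumes "finite N" and "\<And>k. k \<in> K \<Longrightarrow> F k \<subseteq> Pow N"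
    and U: "U = {u. (\<forall>S\<in>Pow N. u S \<ge> 0) \<and> (\<Sum>S\<in>Pow N. u S) = 1 \<and>
                     (\<forall>k\<in>K. (\<Sum>S\<in>F k. u S) = c k)}"
    and "U \<noteq> {}"
  defines "val \<equiv> \<lambda>u. \<Sum>S\<in>Pow N. u S * f S"
  shows "\<exists>u\<in>U. val u = (SUP v\<in>U. val v) \<and> (\<forall>v\<in>U. val v \<le> val u)"
proof -
  define B :: "(nat set \<Rightarrow> real) set"
    where "B = PiE UNIV (\<lambda>S. if S \<in> Pow N then {0..1} else {0})"
  define trunc :: "(nat set \<Rightarrow> real) \<Rightarrow> nat set \<Rightarrow> real"
    where "trunc = (\<lambda>u S. if S \<in> Pow N then u S else 0)"
  have compB: "compact B"
  proof -
    have "compactin (product_topology (\<lambda>_. euclidean) UNIV) B"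
      unfolding B_def compactin_PiE by auto
    then show ?thesis by (simp add: euclidean_product_topology)
  qed
  have cont: "continuous_on UNIV (\<lambda>u :: nat set \<Rightarrow> real. \<Sum>S\<in>G. u S)" for G
    by (intro continuous_intros continuous_on_product_coordinates)
  have "closed U"
  proof -
    have "U = (\<Inter>S\<in>Pow N. {u. u S \<ge> 0}) \<inter> {u. (\<Sum>S\<in>Pow N. u S) = 1} \<inter>
              (\<Inter>k\<in>K. {u. (\<Sum>S\<in>F k. u S) = c k})"
      unfolding U by auto
    then show ?thesis
      by (auto intro!: closed_Int closed_INT closed_Collect_le closed_Collect_eq
          continuous_intros continuous_on_product_coordinates cont)
  qed
  with compB have comp: "compact (B \<inter> U)" by (rule compact_Int_closed)
  have trunc_in: "trunc u \<in> B \<inter> U" if "u \<in> U" for u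
  proof -
    have "u S \<le> 1" if "S \<in> Pow N" for S
      using member_le_sum[of S "Pow N" u] \<open>u \<in> U\<close> that assms(1) unfolding U by auto
    then have "trunc u \<in> B" using that unfolding B_def U trunc_def by auto
    moreover have "(\<Sum>S\<in>F k. trunc u S) = (\<Sum>S\<in>F k. u S)" if "k \<in> K" for k
      using assms(2)[OF that] by (intro sum.cong) (auto simp: trunc_def)
    moreover have "(\<Sum>S\<in>Pow N. trunc u S) = (\<Sum>S\<in>Pow N. u S)"
      by (intro sum.cong) (auto simp: trunc_def)
    ultimately show ?thesis using that unfolding U by (auto simp: trunc_def)
  qed
  have val_trunc: "val (trunc u) = val u" for u
    unfolding val_def by (intro sum.cong) (auto simp: trunc_def)
  have "B \<inter> U \<noteq> {}" using trunc_in \<open>U \<noteq> {}\<close> by blast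
  moreover have "continuous_on (B \<inter> U) val"
    unfolding val_def
    by (rule continuous_on_subset[of UNIV])
      (auto intro!: continuous_intros continuous_on_product_coordinates)
  ultimately obtain u where u: "u \<in> B \<inter> U" "\<forall>v\<in>B \<inter> U. val v \<le> val u"
    using continuous_attains_sup[OF comp] by blast
  have max: "val v \<le> val u" if "v \<in> U" for v
    using u(2)[rule_format, OF trunc_in[OF that]] unfolding val_trunc .
  moreover have "(SUP v\<in>U. val v) = val u"
    using u(1) max by (intro cSup_eq_maximum) auto
  ultimately show ?thesis using u(1) by auto
qed

lemma concave_closure_max:
  assumes "finite N" "\<And>i. i \<in> N \<Longrightarrow> x i \<in> {0..1}"
  shows "\<exists>u\<in>marginal_weights N x. (\<Sum>S\<in>Pow N. u S * f S) = concave_closure N f x \<and>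
           (\<forall>v\<in>marginal_weights N x. (\<Sum>S\<in>Pow N. v S * f S) \<le> (\<Sum>S\<in>Pow N. u S * f S))"
  unfolding concave_closure_def
proof (rule linear_program_attains_sup[where K = N and F = "\<lambda>i. {S. S \<subseteq> N \<and> i \<in> S}" and c = x])
  show "marginal_weights N x \<noteq> {}"
    using pairwise_weights_nonempty[of N x] assms unfolding pairwise_weights_def by blast
qed (use assms in \<open>auto simp: marginal_weights_def\<close>)

lemma pairwise_extension_max:
  assumes "finite N" "\<And>i. i \<in> N \<Longrightarrow> x i \<in> {0..1}"
  shows "\<exists>p\<in>pairwise_weights N x. (\<Sum>S\<in>Pow N. p S * f S) = pairwise_extension N f x \<and>
           (\<forall>q\<in>pairwise_weights N x. (\<Sum>S\<in>Pow N. q S * f S) \<le> (\<Sum>S\<in>Pow N. p S * f S))"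
  unfolding pairwise_extension_def
proof (rule linear_program_attains_sup
    [where K = "{(i, j). i \<in> N \<and> j \<in> N \<and> i \<le> j}"
       and F = "\<lambda>(i, j). {S. S \<subseteq> N \<and> {i, j} \<subseteq> S}"
       and c = "\<lambda>(i, j). if i = j then x i else x i * x j"])
  show "pairwise_weights N x \<noteq> {}"
    by (rule pairwise_weights_nonempty[OF assms])
  show "pairwise_weights N x =
    {u. (\<forall>S\<in>Pow N. u S \<ge> 0) \<and> (\<Sum>S\<in>Pow N. u S) = 1 \<and>
        (\<forall>k\<in>{(i, j). i \<in> N \<and> j \<in> N \<and> i \<le> j}.
           (\<Sum>S\<in>(case k of (i, j) \<Rightarrow> {S. S \<subseteq> N \<and> {i, j} \<subseteq> S}). u S) =
           (case k of (i, j) \<Rightarrow> if i = j then x i else x i * x j))}"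
    unfolding pairwise_weights_def marginal_weights_def
    by (rule set_eqI) (fastforce simp: order.order_iff_strict[where 'a = nat])
qed (use assms in auto)

end

theory Submission imports Defs
begin

text \<open>
  The independent distribution with marginals \<open>x\<close> is pairwise independent, so the multilinear
  extension \<open>F\<close> satisfies \<open>F x \<le> f\<^sup>+\<^sup>+ x\<close>. By submodularity and monotonicity,
  \<open>\<phi> t = F (t x)\<close> satisfies \<open>\<phi>' t \<ge> f\<^sup>+ x - \<phi> t\<close>; hence \<open>exp t * (\<phi> t - f\<^sup>+ x)\<close> is nondecreasing
  and \<open>F x \<ge> (1 - 1/e) f\<^sup>+ x\<close>.

  For the coverage function, choosing one whole block uniformly at random gives
  \<open>f\<^sup>+ = M\<close>, the number of transversals. If \<open>z r\<close> denotes the fraction of the block \<open>A r\<close> that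
  lies in \<open>S\<close>, then \<open>g S = M (1 - (\<Prod>r. 1 - z r))\<close>. Under any pairwise independent
  distribution the expectation of \<open>\<Sum>r. z r\<close> is 1 and that of \<open>\<Sum>r. (z r)\<^sup>2\<close> is at most
  \<open>1/l + 1/m\<close>, where \<open>l\<close> is the smallest block size, so the product has expectation at least
  \<open>1/e - (1/l + 1/m)/2\<close>.
\<close>

section \<open>The multilinear extension and its derivative along rays\<close>

text \<open>For \<open>y\<close> with values in [0,1] this is the expectation of \<open>f\<close> on
  a random set containing each \<open>i\<close> independently with probability \<open>y i\<close>.
  As a polynomial it makes sense for every real \<open>y\<close>, so it can be differentiated along
  whole lines.\<close>

definition multilinear :: "'a set \<Rightarrow> ('a set \<Rightarrow> real) \<Rightarrow> ('a \<Rightarrow> real) \<Rightarrow> real" where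
  "multilinear N f y = (\<Sum>S\<in>Pow N. (prod y S * (\<Prod>i\<in>N - S. 1 - y i)) * f S)"

lemma multilinear_empty [simp]: "multilinear {} f y = f {}"
  by (simp add: multilinear_def)

text \<open>Conditioning on whether \<open>j\<close> belongs to the random set. Being affine in
  \<open>y j\<close>, this recursion drives the induction that computes the derivative.\<close>

lemma multilinear_insert:
  assumes "finite N" "j \<notin> N"
  shows "multilinear (insert j N) f y =
    y j * multilinear N (\<lambda>S. f (insert j S)) y + (1 - y j) * multilinear N f y"
proof -
  let ?w = "\<lambda>N S. prod y S * (\<Prod>i\<in>N - S. 1 - y i)"
  have inj: "inj_on (insert j) (Pow N)"
    using assms by (intro inj_onI) (auto simp: set_eq_iff)
  have "multilinear (insert j N) f y =
      (\<Sum>S\<in>Pow N. ?w (insert j N) S * f S) + (\<Sum>S\<in>insert j ` Pow N. ?w (insert j N) S * f S)"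
    unfolding multilinear_def Pow_insert
    using assms by (intro sum.union_disjoint) auto
  also have "(\<Sum>S\<in>insert j ` Pow N. ?w (insert j N) S * f S) =
      (\<Sum>S\<in>Pow N. y j * (?w N S * f (insert j S)))"
    unfolding sum.reindex[OF inj] o_def
  proof (rule sum.cong)
    fix S assume "S \<in> Pow N"
    then have "j \<notin> S" "finite S" "insert j N - insert j S = N - S"
      using assms finite_subset by auto
    then show "?w (insert j N) (insert j S) * f (insert j S) = y j * (?w N S * f (insert j S))"
      by simp
  qed simp
  also have "(\<Sum>S\<in>Pow N. ?w (insert j N) S * f S) = (\<Sum>S\<in>Pow N. (1 - y j) * (?w N S * f S))"
  proof (rule sum.cong)
    fix S assume "S \<in> Pow N"
    then have "insert j N - S = insert j (N - S)" "j \<notin> N - S" "finite (N - S)"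
      using assms by auto
    then show "?w (insert j N) S * f S = (1 - y j) * (?w N S * f S)"
      by simp
  qed simp
  finally show ?thesis
    by (simp add: multilinear_def sum_distrib_left)
qed

lemma multilinear_cong:
  assumes "\<And>S. S \<subseteq> N \<Longrightarrow> f S = g S"
  shows "multilinear N f y = multilinear N g y"
  using assms by (simp add: multilinear_def)

lemma multilinear_diff:
  "multilinear N (\<lambda>S. f S - g S) y = multilinear N f y - multilinear N g y"
  by (simp add: multilinear_def right_diff_distrib sum_subtractf)

lemma multilinear_sum_cmult:
  "multilinear N (\<lambda>S. \<Sum>i\<in>I. c i * f i S) y = (\<Sum>i\<in>I. c i * multilinear N (f i) y)"
proof -
  have "multilinear N (\<lambda>S. \<Sum>i\<in>I. c i * f i S) y =
      (\<Sum>S\<in>Pow N. \<Sum>i\<in>I. c i * (prod y S * (\<Prod>i\<in>N - S. 1 - y i) * f i S))"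
    unfolding multilinear_def sum_distrib_left by (intro sum.cong refl) (simp add: ac_simps)
  also have "\<dots> = (\<Sum>i\<in>I. \<Sum>S\<in>Pow N. c i * (prod y S * (\<Prod>i\<in>N - S. 1 - y i) * f i S))"
    by (rule sum.swap)
  finally show ?thesis
    by (simp only: multilinear_def sum_distrib_left)
qed

lemma multilinear_const:
  assumes "finite N"
  shows "multilinear N (\<lambda>_. c) y = c"
  using product_weights_superset_sum[OF assms, of "{}" y]
  by (simp add: multilinear_def Pow_def flip: sum_distrib_right)

lemma product_weight_nonneg:
  fixes y :: "'a \<Rightarrow> real"
  assumes "\<And>i. i \<in> N \<Longrightarrow> y i \<in> {0..1}" "S \<subseteq> N"
  shows "prod y S * (\<Prod>i\<in>N - S. 1 - y i) \<ge> 0"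
  using assms by (intro mult_nonneg_nonneg prod_nonneg) auto

lemma multilinear_mono:
  assumes "\<And>i. i \<in> N \<Longrightarrow> y i \<in> {0..1}" "\<And>S. S \<subseteq> N \<Longrightarrow> f S \<le> g S"
  shows "multilinear N f y \<le> multilinear N g y"
  unfolding multilinear_def
  using assms product_weight_nonneg[of N y] by (intro sum_mono mult_left_mono) auto

text \<open>The chain rule: the partial derivative in coordinate \<open>i\<close> is the expected
  gain from having \<open>i\<close> rather than not. Writing \<open>S - {i}\<close> makes that gain
  independent of whether \<open>i\<close> is in \<open>S\<close>, so all summands are expectations
  over the same \<open>N\<close>. The induction keeps \<open>f\<close> arbitrary because the
  recursion replaces it by \<open>\<lambda>S. f (insert j S)\<close>.\<close>

lemma has_real_derivative_multilinear_ray: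
  assumes "finite N"
  shows "((\<lambda>t. multilinear N f (\<lambda>i. t * x i)) has_real_derivative
    (\<Sum>i\<in>N. x i * multilinear N (\<lambda>S. f (insert i S) - f (S - {i})) (\<lambda>i. t * x i))) (at t)"
  using assms
proof (induction N arbitrary: f rule: finite_induct)
  case (insert j N)
  let ?M = "\<lambda>f. multilinear N f (\<lambda>i. t * x i)"
  let ?D = "\<lambda>f. \<Sum>i\<in>N. x i * ?M (\<lambda>S. f (insert i S) - f (S - {i}))"
  let ?fj = "\<lambda>S. f (insert j S)"
  have "multilinear (insert j N) (\<lambda>S. f (insert i S) - f (S - {i})) (\<lambda>i. t * x i) =
      t * x j * ?M (\<lambda>S. ?fj (insert i S) - ?fj (S - {i})) +
      (1 - t * x j) * ?M (\<lambda>S. f (insert i S) - f (S - {i}))" if "i \<in> N" for i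
  proof -
    have "insert j S - {i} = insert j (S - {i})" for S
      using that insert.hyps by auto
    then show ?thesis
      using insert.hyps by (simp add: multilinear_insert insert_commute)
  qed
  then have "(\<Sum>i\<in>N. x i * multilinear (insert j N) (\<lambda>S. f (insert i S) - f (S - {i})) (\<lambda>i. t * x i)) =
      (\<Sum>i\<in>N. x i * (t * x j * ?M (\<lambda>S. ?fj (insert i S) - ?fj (S - {i})) +
        (1 - t * x j) * ?M (\<lambda>S. f (insert i S) - f (S - {i}))))"
    by simp
  also have "\<dots> = t * x j * ?D ?fj + (1 - t * x j) * ?D f"
    unfolding sum_distrib_left sum.distrib[symmetric]
    by (intro sum.cong refl) (simp add: algebra_simps)
  finally have sum_N: "(\<Sum>i\<in>N. x i * multilinear (insert j N) (\<lambda>S. f (insert i S) - f (S - {i})) (\<lambda>i. t * x i)) =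
      t * x j * ?D ?fj + (1 - t * x j) * ?D f" .
  \<comment> \<open>The gain of \<open>j\<close> is the same with and without \<open>j\<close> in
    the set, so the two branches of the recursion agree and \<open>y j\<close> cancels.\<close>
  have summand_j: "multilinear (insert j N) (\<lambda>S. f (insert j S) - f (S - {j})) (\<lambda>i. t * x i) =
      ?M ?fj - ?M f"
  proof -
    have "S - {j} = S" if "S \<subseteq> N" for S
      using that insert.hyps by auto
    then have "?M (\<lambda>S. ?fj S - f (S - {j})) = ?M (\<lambda>S. ?fj S - f S)"
      by (intro multilinear_cong) simp
    then show ?thesis
      using insert.hyps by (simp add: multilinear_insert multilinear_diff algebra_simps)
  qed
  have "((\<lambda>t. t * x j * multilinear N ?fj (\<lambda>i. t * x i) +
        (1 - t * x j) * multilinear N f (\<lambda>i. t * x i)) has_real_derivative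
      x j * ?M ?fj + t * x j * ?D ?fj + (- x j * ?M f + (1 - t * x j) * ?D f)) (at t)"
    by (auto intro!: derivative_eq_intros insert.IH)
  then show ?case
    unfolding multilinear_insert[OF insert.hyps, of f] sum.insert[OF insert.hyps] sum_N summand_j
    by (rule DERIV_cong) (simp add: algebra_simps)
qed simp

section \<open>The bound for monotone submodular functions\<close>

text \<open>Elements of \<open>T\<close> are added to \<open>S\<close> one at a time. By diminishing
  returns each gains at most what it would gain on \<open>S\<close> alone: for \<open>j\<close>
  outside \<open>S\<close>, the sets \<open>S \<union> T\<close> and \<open>insert j S\<close>
  intersect in \<open>S\<close>.\<close>

lemma submodular_union_le:
  assumes "finite T" "T \<subseteq> N" "S \<subseteq> N" "submodular_on N f"
  shows "f (S \<union> T) \<le> f S + (\<Sum>i\<in>T. f (insert i S) - f S)"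
  using assms
proof (induction T rule: finite_induct)
  case (insert j T)
  show ?case
  proof (cases "j \<in> S")
    case True
    then have "S \<union> insert j T = S \<union> T" "insert j S = S"
      by auto
    then show ?thesis
      using insert by simp
  next
    case False
    have "S \<union> T \<in> Pow N" "insert j S \<in> Pow N"
      using insert.prems by auto
    then have "f (S \<union> T) + f (insert j S) \<ge> f ((S \<union> T) \<inter> insert j S) + f ((S \<union> T) \<union> insert j S)"
      using insert.prems(3) unfolding submodular_on_def by blast
    moreover have "(S \<union> T) \<inter> insert j S = S" "(S \<union> T) \<union> insert j S = S \<union> insert j T"
      using False insert.hyps by auto
    ultimately show ?thesis
      using insert by simp
  qed
qed simp

text \<open>Average \<open>f T \<le> f (S \<union> T)\<close> and \<open>submodular_union_le\<close>
  over \<open>T\<close> with weights \<open>u\<close>: the gain of each \<open>i\<close> is then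
  weighted by its marginal \<open>x i\<close>. The right side depends on \<open>u\<close> only
  through \<open>x\<close>.\<close>

lemma marginal_weights_sum_le:
  assumes "finite N" "u \<in> marginal_weights N x" "S \<subseteq> N"
    and "submodular_on N f" "mono_on (Pow N) f" "\<And>i. i \<in> N \<Longrightarrow> 0 \<le> x i"
  shows "(\<Sum>T\<in>Pow N. u T * f T) \<le> f S + (\<Sum>i\<in>N. x i * (f (insert i S) - f (S - {i})))"
proof -
  let ?d = "\<lambda>i. f (insert i S) - f S"
  have u: "\<And>T. T \<subseteq> N \<Longrightarrow> 0 \<le> u T" "(\<Sum>T\<in>Pow N. u T) = 1"
    "\<And>i. i \<in> N \<Longrightarrow> (\<Sum>T | T \<subseteq> N \<and> i \<in> T. u T) = x i"
    using assms(2) by (auto simp: marginal_weights_def)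
  have "(\<Sum>T\<in>Pow N. u T * f T) \<le> (\<Sum>T\<in>Pow N. u T * (f S + (\<Sum>i\<in>T. ?d i)))"
  proof (intro sum_mono mult_left_mono)
    fix T assume T: "T \<in> Pow N"
    have "f T \<le> f (S \<union> T)"
      using T assms by (intro mono_onD[OF assms(5)]) auto
    also have "\<dots> \<le> f S + (\<Sum>i\<in>T. ?d i)"
      using T assms by (intro submodular_union_le[where N = N]) (auto intro: finite_subset)
    finally show "f T \<le> f S + (\<Sum>i\<in>T. ?d i)" .
  qed (use u in auto)
  also have "\<dots> = f S + (\<Sum>T\<in>Pow N. \<Sum>i | i \<in> N \<and> i \<in> T. u T * ?d i)"
  proof -
    have "(\<Sum>T\<in>Pow N. u T * (\<Sum>i\<in>T. ?d i)) = (\<Sum>T\<in>Pow N. \<Sum>i | i \<in> N \<and> i \<in> T. u T * ?d i)"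
      unfolding sum_distrib_left by (intro sum.cong) auto
    then show ?thesis
      using u(2) by (simp add: distrib_left sum.distrib flip: sum_distrib_right)
  qed
  also have "(\<Sum>T\<in>Pow N. \<Sum>i | i \<in> N \<and> i \<in> T. u T * ?d i) =
      (\<Sum>i\<in>N. \<Sum>T | T \<in> Pow N \<and> i \<in> T. u T * ?d i)"
    using assms(1) by (intro sum.swap_restrict) auto
  also have "\<dots> = (\<Sum>i\<in>N. x i * ?d i)"
    using u(3) by (intro sum.cong) (simp_all flip: sum_distrib_right)
  \<comment> \<open>By monotonicity, lowering \<open>f S\<close> to \<open>f (S - {i})\<close> only
    increases the gain; this gives the form occurring in the derivative.\<close>
  also have "\<dots> \<le> (\<Sum>i\<in>N. x i * (f (insert i S) - f (S - {i})))"
    using assms by (intro sum_mono mult_left_mono diff_left_mono mono_onD[OF assms(5)]) auto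
  finally show ?thesis
    by simp
qed

lemma multilinear_ge_marginal_weights_sum:
  assumes "finite N" "u \<in> marginal_weights N x" "\<And>i. i \<in> N \<Longrightarrow> x i \<in> {0..1}"
    and "submodular_on N f" "mono_on (Pow N) f" "f {} \<ge> 0"
  shows "(1 - exp (-1)) * (\<Sum>T\<in>Pow N. u T * f T) \<le> multilinear N f x"
proof -
  define V where "V = (\<Sum>T\<in>Pow N. u T * f T)"
  define \<phi> where "\<phi> = (\<lambda>t. multilinear N f (\<lambda>i. t * x i))"
  define \<phi>' where "\<phi>' = (\<lambda>t. \<Sum>i\<in>N. x i *
    multilinear N (\<lambda>S. f (insert i S) - f (S - {i})) (\<lambda>i. t * x i))"
  \<comment> \<open>The bound of \<open>marginal_weights_sum_le\<close> holds for each fixed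
    \<open>S\<close>; it is averaged over the independent random \<open>S\<close> with marginals
    \<open>t * x i\<close>.\<close>
  have growth: "V - \<phi> t \<le> \<phi>' t" if "0 \<le> t" "t \<le> 1" for t
  proof -
    have "V - \<phi> t = multilinear N (\<lambda>S. V - f S) (\<lambda>i. t * x i)"
      using assms(1) by (simp add: multilinear_diff multilinear_const \<phi>_def)
    also have "\<dots> \<le> multilinear N (\<lambda>S. \<Sum>i\<in>N. x i * (f (insert i S) - f (S - {i}))) (\<lambda>i. t * x i)"
    proof (rule multilinear_mono)
      show "t * x i \<in> {0..1}" if "i \<in> N" for i
        using assms(3)[OF that] \<open>0 \<le> t\<close> \<open>t \<le> 1\<close> by (auto intro: mult_le_one)
      show "V - f S \<le> (\<Sum>i\<in>N. x i * (f (insert i S) - f (S - {i})))" if "S \<subseteq> N" for S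
        using marginal_weights_sum_le[OF assms(1,2) that assms(4,5)] assms(3)
        by (simp add: V_def)
    qed
    also have "\<dots> = \<phi>' t"
      by (simp add: multilinear_sum_cmult \<phi>'_def)
    finally show ?thesis .
  qed
  \<comment> \<open>\<open>exp t\<close> is the integrating factor of the differential inequality in
    \<open>growth\<close>.\<close>
  have "exp 0 * (\<phi> 0 - V) \<le> exp 1 * (\<phi> 1 - V)"
  proof (rule DERIV_nonneg_imp_nondecreasing[of 0 1 "\<lambda>t. exp t * (\<phi> t - V)"])
    fix t :: real assume t: "0 \<le> t" "t \<le> 1"
    have "((\<lambda>t. exp t * (\<phi> t - V)) has_real_derivative exp t * (\<phi> t - V + \<phi>' t)) (at t)"
      unfolding \<phi>_def \<phi>'_def
      by (auto intro!: derivative_eq_intros has_real_derivative_multilinear_ray assms(1)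
          simp: algebra_simps)
    then show "\<exists>y. ((\<lambda>t. exp t * (\<phi> t - V)) has_real_derivative y) (at t) \<and> 0 \<le> y"
      using growth[OF t] by (intro exI conjI) auto
  qed simp
  \<comment> \<open>At \<open>t = 0\<close> the random set is empty with probability one.\<close>
  moreover have "\<phi> 0 = f {}"
  proof -
    have "\<phi> 0 = (\<Sum>S\<in>Pow N. if S = {} then f S else 0)"
      unfolding \<phi>_def multilinear_def using assms(1)
      by (intro sum.cong) (auto dest: finite_subset)
    then show ?thesis
      using assms(1) by simp
  qed
  moreover have "\<phi> 1 = multilinear N f x"
    by (simp add: \<phi>_def)
  ultimately show ?thesis
    using assms(6) unfolding V_def[symmetric] by (simp add: exp_minus field_simps)
qed

text \<open>The product weights are feasible: \<open>product_weights_superset_sum\<close> with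
  \<open>T\<close> empty, a singleton and a pair yields the three kinds of constraints.\<close>

lemma multilinear_le_pairwise_extension:
  assumes "finite N" "\<And>i. i \<in> N \<Longrightarrow> x i \<in> {0..1}"
  shows "multilinear N f x \<le> pairwise_extension N f x"
proof -
  define p where "p = (\<lambda>S. prod x S * (\<Prod>i\<in>N - S. 1 - x i))"
  have sup: "(\<Sum>S | S \<subseteq> N \<and> T \<subseteq> S. p S) = prod x T" if "T \<subseteq> N" for T
    unfolding p_def using assms(1) that by (rule product_weights_superset_sum)
  have "p \<in> pairwise_weights N x"
    unfolding pairwise_weights_def marginal_weights_def
  proof (intro CollectI conjI ballI impI)
    show "p S \<ge> 0" if "S \<in> Pow N" for S
      using that assms(2) product_weight_nonneg[of N x S] by (simp add: p_def)
    show "sum p (Pow N) = 1"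
      using sup[of "{}"] by (simp add: Pow_def)
    show "(\<Sum>S | S \<subseteq> N \<and> i \<in> S. p S) = x i" if "i \<in> N" for i
      using sup[of "{i}"] that by simp
    show "(\<Sum>S | S \<subseteq> N \<and> {i, j} \<subseteq> S. p S) = x i * x j" if "i \<in> N" "j \<in> N" "i < j" for i j
      using sup[of "{i, j}"] that by simp
  qed
  then show ?thesis
    using pairwise_extension_max[of N x f] assms
    by (auto simp: multilinear_def p_def)
qed

text \<open>Stated without division, so that for the coverage function it also proves that the
  denominator of the ratio is positive.\<close>

lemma concave_closure_le_pairwise_extension:
  assumes "finite N" "\<And>i. i \<in> N \<Longrightarrow> x i \<in> {0..1}"
    and "submodular_on N f" "mono_on (Pow N) f" "f {} \<ge> 0"
  shows "(1 - exp (-1)) * concave_closure N f x \<le> pairwise_extension N f x"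
proof -
  obtain u where "u \<in> marginal_weights N x" "(\<Sum>S\<in>Pow N. u S * f S) = concave_closure N f x"
    using concave_closure_max[of N x f] assms(1,2) by blast
  then show ?thesis
    using multilinear_ge_marginal_weights_sum[of N u x f] multilinear_le_pairwise_extension[of N x f]
      assms by fastforce
qed

section \<open>The coverage function of the transversals\<close>

text \<open>True for each \<open>H\<close> separately: if \<open>S \<union> T\<close> meets
  \<open>H\<close> then \<open>S\<close> or \<open>T\<close> does, and if
  \<open>S \<inter> T\<close> meets \<open>H\<close> then both do.\<close>

lemma transversal_coverage_submodular:
  assumes "finite (transversals m A)"
  shows "submodular_on N (transversal_coverage m A)"
  unfolding submodular_on_def transversal_coverage_def sum.distrib[symmetric]
  by (intro ballI sum_mono) (auto simp: of_bool_def)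

lemma transversal_coverage_mono: "mono_on B (transversal_coverage m A)"
  unfolding transversal_coverage_def
  by (intro mono_onI sum_mono) (auto simp: of_bool_def)

text \<open>Count the complement: a transversal avoiding \<open>S\<close> chooses its element of
  each block from \<open>A r - S\<close>.\<close>

lemma transversal_coverage_eq:
  assumes "disjoint_family_on A {1..m}" "\<And>r. r \<in> {1..m} \<Longrightarrow> finite (A r)"
  shows "transversal_coverage m A S =
    (\<Prod>r=1..m. real (card (A r))) - (\<Prod>r=1..m. real (card (A r - S)))"
proof -
  let ?P = "\<Pi>\<^sub>E r\<in>{1..m}. A r"
  \<comment> \<open>Since the blocks are disjoint, an element reveals the index at which it was
    chosen; so transversals may be counted as choice functions.\<close>
  have inj: "inj_on (\<lambda>h. h ` {1..m}) ?P"
  proof (rule inj_onI)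
    fix h h' assume h: "h \<in> ?P" "h' \<in> ?P" and eq: "h ` {1..m} = h' ` {1..m}"
    show "h = h'"
    proof (rule PiE_ext[OF h])
      fix r assume r: "r \<in> {1..m}"
      then obtain s where s: "s \<in> {1..m}" "h r = h' s"
        using eq by (metis imageE imageI)
      have "h r \<in> A r" "h' s \<in> A s"
        using PiE_mem[OF h(1) r] PiE_mem[OF h(2) s(1)] by auto
      then have "r = s"
        using s r disjoint_family_onD[OF assms(1)] by (metis disjoint_iff)
      then show "h r = h' r"
        using s by simp
    qed
  qed
  have fin: "finite ?P"
    using assms(2) by (intro finite_PiE) auto
  have avoid: "{h \<in> ?P. S \<inter> h ` {1..m} = {}} = (\<Pi>\<^sub>E r\<in>{1..m}. A r - S)"
  proof -
    have "S \<inter> h ` {1..m} = {} \<longleftrightarrow> (\<forall>r\<in>{1..m}. h r \<notin> S)" for h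
      by blast
    then show ?thesis
      unfolding PiE_iff set_eq_iff mem_Collect_eq Diff_iff by metis
  qed
  have "transversal_coverage m A S = (\<Sum>h\<in>?P. 1 - of_bool (S \<inter> h ` {1..m} = {}))"
    unfolding transversal_coverage_def transversals_def sum.reindex[OF inj] o_def
    by (intro sum.cong) auto
  also have "\<dots> = real (card ?P) - real (card {h \<in> ?P. S \<inter> h ` {1..m} = {}})"
    using fin by (simp add: sum_subtractf of_bool_def sum.If_cases Int_def)
  finally show ?thesis
    unfolding avoid by (simp add: card_PiE)
qed

section \<open>First and second moments of block counts\<close>

lemma sum_mult_of_bool_Pow:
  assumes "finite N"
  shows "(\<Sum>S\<in>Pow N. p S * of_bool (P S)) = (\<Sum>S | S \<subseteq> N \<and> P S. p S :: real)"
  using assms by (intro sum.mono_neutral_cong_right) auto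

lemma card_Int_eq_sum: "finite B \<Longrightarrow> real (card (S \<inter> B)) = (\<Sum>i\<in>B. of_bool (i \<in> S))"
  by (simp add: of_bool_def sum.If_cases Int_commute)

lemma marginal_weights_card_sum:
  assumes "finite N" "p \<in> marginal_weights N (\<lambda>_. q)" "B \<subseteq> N"
  shows "(\<Sum>S\<in>Pow N. p S * real (card (S \<inter> B))) = real (card B) * q"
proof -
  have B: "finite B"
    using assms by (auto intro: finite_subset)
  have "(\<Sum>S\<in>Pow N. p S * real (card (S \<inter> B))) = (\<Sum>i\<in>B. \<Sum>S\<in>Pow N. p S * of_bool (i \<in> S))"
    unfolding card_Int_eq_sum[OF B] sum_distrib_left by (rule sum.swap)
  also have "\<dots> = (\<Sum>i\<in>B. q)"
    using assms(2,3) unfolding sum_mult_of_bool_Pow[OF assms(1)] marginal_weights_def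
    by (intro sum.cong) auto
  finally show ?thesis
    by simp
qed

text \<open>The squared count is the number of ordered pairs from \<open>B\<close> inside
  \<open>S\<close>. Off-diagonal pairs have probability \<open>q\<^sup>2\<close>, diagonal ones
  \<open>q\<close>; bounding the latter by \<open>q + q\<^sup>2\<close> completes the
  square.\<close>

lemma pairwise_weights_card_square_sum_le:
  assumes "finite N" "p \<in> pairwise_weights N (\<lambda>_. q)" "B \<subseteq> N" "0 \<le> q"
  shows "(\<Sum>S\<in>Pow N. p S * (real (card (S \<inter> B)))\<^sup>2) \<le> real (card B) * q + (real (card B) * q)\<^sup>2"
proof -
  have B: "finite B"
    using assms by (auto intro: finite_subset)
  have pair: "(\<Sum>S | S \<subseteq> N \<and> {i, j} \<subseteq> S. p S) \<le> of_bool (i = j) * q + q\<^sup>2"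
    if "i \<in> B" "j \<in> B" for i j
  proof -
    have "i \<in> N" "j \<in> N"
      using that assms(3) by auto
    then consider "i = j" | "i < j" | "j < i"
      by linarith
    then show ?thesis
    proof cases
      case 1
      then show ?thesis
        using assms(2) \<open>i \<in> N\<close> by (simp add: pairwise_weights_def marginal_weights_def)
    next
      case 2
      then show ?thesis
        using assms(2) \<open>i \<in> N\<close> \<open>j \<in> N\<close> by (simp add: pairwise_weights_def power2_eq_square)
    \<comment> \<open>The constraints in \<open>pairwise_weights\<close> are imposed only for
      ordered indices, so this case swaps \<open>i\<close> and \<open>j\<close>.\<close>
    next
      case 3
      then have "(\<Sum>S | S \<subseteq> N \<and> {j, i} \<subseteq> S. p S) = q * q"
        using assms(2) \<open>i \<in> N\<close> \<open>j \<in> N\<close> by (simp add: pairwise_weights_def)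
      then show ?thesis
        using 3 by (simp add: insert_commute power2_eq_square)
    qed
  qed
  have "(\<Sum>S\<in>Pow N. p S * (real (card (S \<inter> B)))\<^sup>2) =
      (\<Sum>S\<in>Pow N. \<Sum>(i, j)\<in>B \<times> B. p S * of_bool ({i, j} \<subseteq> S))"
  proof (intro sum.cong refl)
    fix S
    have "(real (card (S \<inter> B)))\<^sup>2 = (\<Sum>(i, j)\<in>B \<times> B. of_bool ({i, j} \<subseteq> S))"
      unfolding card_Int_eq_sum[OF B] power2_eq_square sum_product sum.cartesian_product
      by (intro sum.cong) auto
    then show "p S * (real (card (S \<inter> B)))\<^sup>2 = (\<Sum>(i, j)\<in>B \<times> B. p S * of_bool ({i, j} \<subseteq> S))"
      by (simp add: sum_distrib_left case_prod_beta)
  qed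
  also have "\<dots> = (\<Sum>(i, j)\<in>B \<times> B. \<Sum>S\<in>Pow N. p S * of_bool ({i, j} \<subseteq> S))"
    by (subst sum.swap) (simp add: case_prod_beta)
  also have "\<dots> \<le> (\<Sum>(i, j)\<in>B \<times> B. of_bool (i = j) * q + q\<^sup>2)"
    unfolding sum_mult_of_bool_Pow[OF assms(1)] using pair by (intro sum_mono) auto
  also have "\<dots> = real (card B) * q + (real (card B) * q)\<^sup>2"
  proof -
    have "(\<Sum>j\<in>B. of_bool (i = j) * q + q\<^sup>2) = q + real (card B) * q\<^sup>2" if "i \<in> B" for i
      using B that by (simp add: sum.distrib flip: sum_distrib_right)
    then have "(\<Sum>(i, j)\<in>B \<times> B. of_bool (i = j) * q + q\<^sup>2) = (\<Sum>i\<in>B. q + real (card B) * q\<^sup>2)"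
      unfolding sum.cartesian_product[symmetric] by (intro sum.cong) auto
    then show ?thesis
      by (simp add: power2_eq_square algebra_simps)
  qed
  finally show ?thesis .
qed

section \<open>Comparing products with exponentials\<close>

lemma exp_minus_le_quadratic:
  fixes z :: real
  assumes "0 \<le> z"
  shows "exp (-z) \<le> 1 - z + z\<^sup>2 / 2"
proof -
  have pos: "0 \<le> 1 - z + z\<^sup>2 / 2"
    using sum_squares_ge_zero[of "z - 1" 1] by (simp add: power2_eq_square algebra_simps)
  \<comment> \<open>The product equals \<open>1 + z^4 / 4\<close>.\<close>
  have "1 \<le> (1 - z + z\<^sup>2 / 2) * (1 + z + z\<^sup>2 / 2)"
    using zero_le_power[of "z\<^sup>2" 2] by (simp add: power2_eq_square algebra_simps)
  also have "\<dots> \<le> (1 - z + z\<^sup>2 / 2) * exp z"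
    using exp_lower_Taylor_quadratic[OF assms] pos by (intro mult_left_mono) auto
  finally show ?thesis
    by (simp add: exp_minus field_simps)
qed

text \<open>The product is compared with \<open>exp (- sum z I)\<close>, which is then bounded below by its
  tangent at \<open>sum z I = 1\<close>; this linearizes the dependence on the sum, so that only first and
  second moments of the \<open>z i\<close> enter.\<close>

lemma prod_one_minus_ge:
  fixes z :: "'a \<Rightarrow> real"
  assumes "finite I" "\<And>i. i \<in> I \<Longrightarrow> z i \<in> {0..1}"
  shows "(\<Prod>i\<in>I. 1 - z i) \<ge> exp (-1) * (2 - (\<Sum>i\<in>I. z i)) - (\<Sum>i\<in>I. (z i)\<^sup>2) / 2"
proof -
  have "exp (-1) * (2 - sum z I) \<le> exp (-1) * exp (1 - sum z I)"
    using exp_ge_add_one_self[of "1 - sum z I"] by (intro mult_left_mono) auto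
  also have "\<dots> = (\<Prod>i\<in>I. exp (- z i))"
    using assms(1) by (simp add: exp_sum[symmetric] exp_add[symmetric] sum_negf)
  finally have 1: "exp (-1) * (2 - sum z I) \<le> (\<Prod>i\<in>I. exp (- z i))" .
  have "(\<Prod>i\<in>I. exp (- z i)) - (\<Prod>i\<in>I. 1 - z i) \<le> norm ((\<Prod>i\<in>I. exp (- z i)) - (\<Prod>i\<in>I. 1 - z i))"
    by simp
  \<comment> \<open>All factors have absolute value at most 1, so exchanging them one at a time
    costs at most the sum of the individual differences.\<close>
  also have "\<dots> \<le> (\<Sum>i\<in>I. norm (exp (- z i) - (1 - z i)))"
    using assms(2) by (intro norm_prod_diff) auto
  also have "\<dots> \<le> (\<Sum>i\<in>I. (z i)\<^sup>2 / 2)"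
  proof (rule sum_mono)
    fix i assume "i \<in> I"
    then show "norm (exp (- z i) - (1 - z i)) \<le> (z i)\<^sup>2 / 2"
      using exp_minus_le_quadratic[of "z i"] exp_ge_add_one_self[of "- z i"] assms(2)[of i] by auto
  qed
  finally show ?thesis
    using 1 by (simp add: sum_divide_distrib)
qed

section \<open>Both extensions of the coverage function at the constant vector\<close>

text \<open>By \<open>prod_one_minus_ge\<close> the coverage has an upper bound affine in the sums
  of \<open>z S r\<close> and of its square. Its expectation under an optimal \<open>p\<close>
  therefore needs only two moments, and the main term is
  \<open>1 - exp (-1) * (2 - 1)\<close>.\<close>

lemma pairwise_extension_transversal_coverage_le:
  assumes "finite N" "disjoint_family_on A {1..m}" "\<And>r. r \<in> {1..m} \<Longrightarrow> A r \<subseteq> N"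
    and "\<And>r. r \<in> {1..m} \<Longrightarrow> l \<le> card (A r)" "1 \<le> l" "1 \<le> m"
  shows "pairwise_extension N (transversal_coverage m A) (\<lambda>_. 1 / real m) \<le>
    (\<Prod>r=1..m. real (card (A r))) * (1 - exp (-1) + (1 / real l + 1 / real m) / 2)"
proof -
  define M where "M = (\<Prod>r=1..m. real (card (A r)))"
  define z where "z = (\<lambda>S r. real (card (S \<inter> A r)) / real (card (A r)))"
  obtain p where p: "p \<in> pairwise_weights N (\<lambda>_. 1 / real m)"
    and ext: "(\<Sum>S\<in>Pow N. p S * transversal_coverage m A S) =
      pairwise_extension N (transversal_coverage m A) (\<lambda>_. 1 / real m)"
    using pairwise_extension_max[OF assms(1), of "\<lambda>_. 1 / real m" "transversal_coverage m A"]
      assms(6) by auto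
  have pm: "p \<in> marginal_weights N (\<lambda>_. 1 / real m)"
    using p by (simp add: pairwise_weights_def)
  then have p_nonneg: "\<And>S. S \<in> Pow N \<Longrightarrow> 0 \<le> p S" and p_sum: "sum p (Pow N) = 1"
    by (auto simp: marginal_weights_def)
  have A_fin: "finite (A r)" and A_pos: "0 < card (A r)" if "r \<in> {1..m}" for r
    using that assms(1,3,5) assms(4)[OF that] by (auto intro: finite_subset)
  have M: "0 \<le> M"
    by (simp add: M_def prod_nonneg)
  have cov: "transversal_coverage m A S \<le>
      M * (1 - (exp (-1) * (2 - (\<Sum>r=1..m. z S r)) - (\<Sum>r=1..m. (z S r)\<^sup>2) / 2))" for S
  proof -
    have "real (card (A r - S)) = real (card (A r)) * (1 - z S r)" if "r \<in> {1..m}" for r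
    proof -
      have "card (A r \<inter> S) \<le> card (A r)" "card (A r - S) = card (A r) - card (A r \<inter> S)"
        using A_fin[OF that] by (auto intro: card_mono card_Diff_subset_Int)
      then show ?thesis
        using A_pos[OF that] by (simp add: z_def Int_commute of_nat_diff field_simps)
    qed
    then have "(\<Prod>r=1..m. real (card (A r - S))) = M * (\<Prod>r=1..m. 1 - z S r)"
      unfolding M_def prod.distrib[symmetric] by (intro prod.cong) auto
    then have "transversal_coverage m A S = M * (1 - (\<Prod>r=1..m. 1 - z S r))"
      using transversal_coverage_eq[OF assms(2) A_fin] by (simp add: M_def right_diff_distrib)
    moreover have "z S r \<in> {0..1}" if "r \<in> {1..m}" for r
      using A_fin[OF that] A_pos[OF that] by (auto simp: z_def divide_le_eq intro: card_mono)
    ultimately show ?thesis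
      using M prod_one_minus_ge[of "{1..m}" "z S"] by (auto intro!: mult_left_mono)
  qed
  have z1: "(\<Sum>S\<in>Pow N. p S * (\<Sum>r=1..m. z S r)) = 1"
  proof -
    have "(\<Sum>S\<in>Pow N. p S * (\<Sum>r=1..m. z S r)) =
        (\<Sum>r=1..m. (\<Sum>S\<in>Pow N. p S * real (card (S \<inter> A r))) / real (card (A r)))"
      unfolding z_def sum_distrib_left sum_divide_distrib
      by (subst sum.swap) (intro sum.cong refl, simp)
    also have "\<dots> = (\<Sum>r=1..m. 1 / real m)"
    proof (rule sum.cong)
      fix r assume r: "r \<in> {1..m}"
      show "(\<Sum>S\<in>Pow N. p S * real (card (S \<inter> A r))) / real (card (A r)) = 1 / real m"
        using A_pos[OF r] by (subst marginal_weights_card_sum[OF assms(1) pm assms(3)[OF r]]) simp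
    qed simp
    finally show ?thesis
      using assms(6) by simp
  qed
  have z2: "(\<Sum>S\<in>Pow N. p S * (\<Sum>r=1..m. (z S r)\<^sup>2)) \<le> 1 / real l + 1 / real m"
  proof -
    have "(\<Sum>S\<in>Pow N. p S * (\<Sum>r=1..m. (z S r)\<^sup>2)) =
        (\<Sum>r=1..m. (\<Sum>S\<in>Pow N. p S * (real (card (S \<inter> A r)))\<^sup>2) / (real (card (A r)))\<^sup>2)"
      unfolding z_def sum_distrib_left sum_divide_distrib
      by (subst sum.swap) (intro sum.cong refl, simp add: power_divide)
    \<comment> \<open>A block of size \<open>c\<close> contributes at most
      \<open>(c/m + (c/m)^2) / c^2 = 1/(m c) + 1/m^2\<close>, and \<open>c\<close> is at least
      \<open>l\<close>.\<close>
    also have "\<dots> \<le> (\<Sum>r=1..m. 1 / (real m * real l) + (1 / real m)\<^sup>2)"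
    proof (rule sum_mono)
      fix r assume r: "r \<in> {1..m}"
      let ?c = "real (card (A r))"
      have "(\<Sum>S\<in>Pow N. p S * (real (card (S \<inter> A r)))\<^sup>2) / ?c\<^sup>2 \<le>
          (?c * (1 / real m) + (?c * (1 / real m))\<^sup>2) / ?c\<^sup>2"
        using pairwise_weights_card_square_sum_le[OF assms(1) p assms(3)[OF r]]
        by (intro divide_right_mono) auto
      also have "\<dots> = 1 / (real m * ?c) + (1 / real m)\<^sup>2"
        using A_pos[OF r] assms(6) by (simp add: field_simps power2_eq_square)
      also have "1 / (real m * ?c) \<le> 1 / (real m * real l)"
        using assms(4)[OF r] assms(5,6) by (intro divide_left_mono mult_left_mono) auto
      finally show "(\<Sum>S\<in>Pow N. p S * (real (card (S \<inter> A r)))\<^sup>2) / ?c\<^sup>2 \<le>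
          1 / (real m * real l) + (1 / real m)\<^sup>2"
        by simp
    qed
    also have "\<dots> = 1 / real l + 1 / real m"
      using assms(5,6) by (simp add: field_simps power2_eq_square)
    finally show ?thesis .
  qed
  have "(\<Sum>S\<in>Pow N. p S * transversal_coverage m A S) \<le>
      (\<Sum>S\<in>Pow N. p S *
        (M * (1 - (exp (-1) * (2 - (\<Sum>r=1..m. z S r)) - (\<Sum>r=1..m. (z S r)\<^sup>2) / 2))))"
    using p_nonneg cov by (intro sum_mono mult_left_mono)
  \<comment> \<open>Regrouped so that the total mass and the two moments appear as separate
    sums.\<close>
  also have "\<dots> = (\<Sum>S\<in>Pow N. M * ((1 - 2 * exp (-1)) * p S +
      exp (-1) * (p S * (\<Sum>r=1..m. z S r)) + (p S * (\<Sum>r=1..m. (z S r)\<^sup>2)) / 2))"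
    by (intro sum.cong refl) (simp add: algebra_simps)
  also have "\<dots> = M * ((1 - 2 * exp (-1)) * sum p (Pow N) +
      exp (-1) * (\<Sum>S\<in>Pow N. p S * (\<Sum>r=1..m. z S r)) +
      (\<Sum>S\<in>Pow N. p S * (\<Sum>r=1..m. (z S r)\<^sup>2)) / 2)"
    by (simp only: sum_distrib_left[symmetric] sum_divide_distrib[symmetric] sum.distrib)
  also have "\<dots> \<le> M * (1 - exp (-1) + (1 / real l + 1 / real m) / 2)"
    unfolding p_sum z1 using M z2 by (intro mult_left_mono) auto
  finally show ?thesis
    unfolding ext M_def .
qed

text \<open>No set meets more than all transversals, and a whole block meets every one of them; the
  uniform distribution on blocks has the required marginals because each element lies in exactly one
  block.\<close>

lemma concave_closure_transversal_coverage:
  assumes "finite N" "disjoint_family_on A {1..m}" "(\<Union>r\<in>{1..m}. A r) = N" "1 \<le> m"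
  shows "concave_closure N (transversal_coverage m A) (\<lambda>_. 1 / real m) =
    (\<Prod>r=1..m. real (card (A r)))"
proof (rule antisym)
  let ?g = "transversal_coverage m A"
  let ?M = "\<Prod>r=1..m. real (card (A r))"
  have A: "A r \<subseteq> N" "finite (A r)" if "r \<in> {1..m}" for r
    using that assms(1,3) by (auto intro: finite_subset)
  have max: "\<exists>u\<in>marginal_weights N (\<lambda>_. 1 / real m).
      (\<Sum>S\<in>Pow N. u S * ?g S) = concave_closure N ?g (\<lambda>_. 1 / real m) \<and>
      (\<forall>v\<in>marginal_weights N (\<lambda>_. 1 / real m).
        (\<Sum>S\<in>Pow N. v S * ?g S) \<le> (\<Sum>S\<in>Pow N. u S * ?g S))"
    using assms(4) by (intro concave_closure_max[OF assms(1)]) auto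
  have cov: "?g S = ?M - (\<Prod>r=1..m. real (card (A r - S)))" for S
    using assms(2) A(2) by (rule transversal_coverage_eq)
  show "concave_closure N ?g (\<lambda>_. 1 / real m) \<le> ?M"
  proof -
    obtain u where u: "u \<in> marginal_weights N (\<lambda>_. 1 / real m)"
      "(\<Sum>S\<in>Pow N. u S * ?g S) = concave_closure N ?g (\<lambda>_. 1 / real m)"
      using max by blast
    have "(\<Sum>S\<in>Pow N. u S * ?g S) \<le> (\<Sum>S\<in>Pow N. u S * ?M)"
      using u(1) unfolding cov
      by (intro sum_mono mult_left_mono) (auto simp: marginal_weights_def intro: prod_nonneg)
    also have "\<dots> = ?M"
      using u(1) by (simp add: marginal_weights_def flip: sum_distrib_right)
    finally show ?thesis
      unfolding u(2) .
  qed
  \<comment> \<open>Summing over indices counts blocks with multiplicity, so the total mass is 1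
    even if several blocks are empty and hence equal.\<close>
  define v where "v = (\<lambda>S. (\<Sum>r=1..m. of_bool (S = A r)) / real m)"
  have v: "(\<Sum>S\<in>F. v S * h S) = (\<Sum>r=1..m. of_bool (A r \<in> F) * h (A r)) / real m"
    if "F \<subseteq> Pow N" for F h
  proof -
    have "finite F"
      using that assms(1) by (auto intro: finite_subset)
    have "(\<Sum>S\<in>F. v S * h S) = (\<Sum>r=1..m. \<Sum>S\<in>F. if S = A r then h (A r) else 0) / real m"
      unfolding v_def sum_divide_distrib sum_distrib_right
      by (subst sum.swap) (intro sum.cong refl, auto)
    then show ?thesis
      using \<open>finite F\<close> by (simp add: of_bool_def if_distrib[of "\<lambda>x. x * _"] cong: if_cong)
  qed
  have in_Pow: "A r \<in> Pow N" if "r \<in> {1..m}" for r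
    using A(1)[OF that] by simp
  have v_Pow: "(\<Sum>S\<in>Pow N. v S * h S) = (\<Sum>r=1..m. h (A r)) / real m" for h
  proof -
    have "(\<Sum>r=1..m. of_bool (A r \<in> Pow N) * h (A r)) = (\<Sum>r=1..m. h (A r))"
      using in_Pow by (intro sum.cong) auto
    then show ?thesis
      using v[of "Pow N" h] by simp
  qed
  have "v \<in> marginal_weights N (\<lambda>_. 1 / real m)"
    unfolding marginal_weights_def
  proof (intro CollectI conjI ballI)
    show "0 \<le> v S" for S
      by (simp add: v_def sum_nonneg)
    show "sum v (Pow N) = 1"
      using v_Pow[of "\<lambda>_. 1"] assms(4) by simp
    fix i assume "i \<in> N"
    then obtain s where s: "s \<in> {1..m}" "i \<in> A s"
      using assms(3) by blast
    then have "A r \<in> {S. S \<subseteq> N \<and> i \<in> S} \<longleftrightarrow> r = s" if "r \<in> {1..m}" for r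
      using that A(1)[OF that] assms(2) unfolding disjoint_family_on_def by blast
    then have "(\<Sum>r=1..m. of_bool (A r \<in> {S. S \<subseteq> N \<and> i \<in> S})) = (\<Sum>r=1..m. of_bool (r = s) :: real)"
      by (intro sum.cong) auto
    also have "\<dots> = 1"
      using s by (simp add: of_bool_def)
    finally show "(\<Sum>S | S \<subseteq> N \<and> i \<in> S. v S) = 1 / real m"
      using v[of "{S. S \<subseteq> N \<and> i \<in> S}" "\<lambda>_. 1"] by auto
  qed
  moreover have "(\<Sum>S\<in>Pow N. v S * ?g S) = ?M"
  proof -
    have "?g (A r) = ?M" if "r \<in> {1..m}" for r
      \<comment> \<open>For \<open>S = A r\<close> the factor with index \<open>r\<close> in the
        second product is the size of the empty set.\<close>
      unfolding cov using that by (subst (2) prod_zero) (auto intro!: bexI[of _ r])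
    then show ?thesis
      using v_Pow[of ?g] assms(4) by simp
  qed
  ultimately show "?M \<le> concave_closure N ?g (\<lambda>_. 1 / real m)"
    using max by metis
qed

section \<open>Block partitions and the limit of the ratio\<close>

lemma block_partition_card_ge:
  assumes "block_partition n m A" "r \<in> {1..m}"
  shows "n div m \<le> card (A r)"
proof (cases "r = m")
  case True
  have "(m - 1) * (n div m) + n div m = m * (n div m)"
    using assms(2) by (cases m) auto
  also have "\<dots> \<le> n"
    by (rule times_div_less_eq_dividend)
  finally show ?thesis
    using True assms(1) by (simp add: block_partition_def)
next
  case False
  then show ?thesis
    using assms by (auto simp: block_partition_def)
qed

text \<open>Explicit bounds for a sandwich argument. The error term uses \<open>2 * m / n\<close> in
  place of \<open>1 / (n div m)\<close> so that \<open>m = o(n)\<close> applies to it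
  directly.\<close>

lemma transversal_coverage_ratio_bounds:
  assumes "block_partition n m A" "1 \<le> m" "m \<le> n"
  defines "\<rho> \<equiv> concave_closure {1..n} (transversal_coverage m A) (\<lambda>_. 1 / real m) /
    pairwise_extension {1..n} (transversal_coverage m A) (\<lambda>_. 1 / real m)"
  shows "\<rho> \<le> 1 / (1 - exp (-1))"
    and "\<rho> \<ge> 1 / (1 - exp (-1) + (2 * real m / real n + 1 / real m) / 2)"
proof -
  let ?g = "transversal_coverage m A"
  let ?P = "pairwise_extension {1..n} ?g (\<lambda>_. 1 / real m)"
  define M where "M = (\<Prod>r=1..m. real (card (A r)))"
  have A: "disjoint_family_on A {1..m}" "(\<Union>r\<in>{1..m}. A r) = {1..n}"
    using assms(1) by (auto simp: block_partition_def)
  have l: "1 \<le> n div m"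
    using assms(2,3) by (simp add: div_greater_zero_iff Suc_le_eq)
  have A_fin: "finite (A r)" if "r \<in> {1..m}" for r
    using that A(2) by (metis finite_UN finite_atLeastAtMost)
  have "M > 0"
    unfolding M_def using block_partition_card_ge[OF assms(1)] l by (intro prod_pos) fastforce
  have closure: "concave_closure {1..n} ?g (\<lambda>_. 1 / real m) = M"
    unfolding M_def using A assms(2) by (intro concave_closure_transversal_coverage) auto
  have "finite (transversals m A)"
    unfolding transversals_def using A_fin by (intro finite_imageI finite_PiE) auto
  then have lower: "(1 - exp (-1)) * M \<le> ?P"
    unfolding closure[symmetric] using assms(2)
    by (intro concave_closure_le_pairwise_extension transversal_coverage_submodular
        transversal_coverage_mono) (auto simp: transversal_coverage_def)
  have e: "0 < 1 - exp (-1 :: real)"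
    by simp
  then have P: "0 < ?P"
    using lower \<open>M > 0\<close> by (smt (verit) mult_pos_pos)
  show "\<rho> \<le> 1 / (1 - exp (-1))"
    unfolding \<rho>_def closure using lower P e by (simp add: field_simps)
  have n: "real n \<le> real m * real (n div m) + real m"
  proof -
    have "n \<le> m * (n div m) + m"
      using mult_div_mod_eq[of m n] mod_less_divisor[of m n] assms(2) by linarith
    then show ?thesis
      by (metis of_nat_add of_nat_le_iff of_nat_mult)
  qed
  have "real m \<le> real m * real (n div m)"
    using l mult_left_mono[of 1 "real (n div m)" "real m"] by simp
  \<comment> \<open>With \<open>l = n div m\<close> at least 1,
    \<open>n \<le> m * l + m \<le> 2 * m * l\<close>.\<close>
  with n have "real n \<le> 2 * real m * real (n div m)"
    by linarith
  then have "1 / real (n div m) \<le> 2 * real m / real n"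
    using l assms(2,3) by (simp add: field_simps)
  then have "M * (1 - exp (-1) + (1 / real (n div m) + 1 / real m) / 2) \<le>
      M * (1 - exp (-1) + (2 * real m / real n + 1 / real m) / 2)"
    using \<open>M > 0\<close> by (intro mult_left_mono add_left_mono divide_right_mono add_right_mono) auto
  moreover have "?P \<le> M * (1 - exp (-1) + (1 / real (n div m) + 1 / real m) / 2)"
    unfolding M_def using A l assms(2) block_partition_card_ge[OF assms(1)]
    by (intro pairwise_extension_transversal_coverage_le) auto
  ultimately have upper: "?P \<le> M * (1 - exp (-1) + (2 * real m / real n + 1 / real m) / 2)"
    by linarith
  have "0 < 1 - exp (-1) + (2 * real m / real n + 1 / real m) / 2"
    using e by (intro add_pos_nonneg) auto
  then show "\<rho> \<ge> 1 / (1 - exp (-1) + (2 * real m / real n + 1 / real m) / 2)"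
    unfolding \<rho>_def closure using upper P by (simp add: divide_le_eq le_divide_eq mult.commute)
qed

theorem theorem2:
  "(\<forall>(n::nat) (f :: nat set \<Rightarrow> real) (x :: nat \<Rightarrow> real).
      n \<ge> 1 \<longrightarrow>
      (\<forall>S\<in>Pow {1..n}. f S \<ge> 0) \<longrightarrow>
      mono_on (Pow {1..n}) f \<longrightarrow>
      submodular_on {1..n} f \<longrightarrow>
      (\<forall>i\<in>{1..n}. x i \<in> {0..1}) \<longrightarrow>
      pairwise_extension {1..n} f x > 0 \<longrightarrow>
      concave_closure {1..n} f x / pairwise_extension {1..n} f x \<le> exp 1 / (exp 1 - 1))
   \<and>
   (\<forall>(m :: nat \<Rightarrow> nat) (A :: nat \<Rightarrow> nat \<Rightarrow> nat set).
      (\<forall>n\<ge>1. 1 \<le> m n \<and> m n \<le> n) \<longrightarrow>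
      filterlim m at_top sequentially \<longrightarrow>
      (\<lambda>n. real (m n)) \<in> o(\<lambda>n. real n) \<longrightarrow>
      (\<forall>n\<ge>1. block_partition n (m n) (A n)) \<longrightarrow>
      (\<lambda>n. concave_closure {1..n} (transversal_coverage (m n) (A n)) (\<lambda>i. 1 / real (m n)) /
            pairwise_extension {1..n} (transversal_coverage (m n) (A n)) (\<lambda>i. 1 / real (m n)))
        \<longlonglongrightarrow> exp 1 / (exp 1 - 1))"
proof (intro conjI allI impI)
  have e: "exp 1 / (exp 1 - 1) = 1 / (1 - exp (-1 :: real))"
    by (simp add: exp_minus field_simps)
  {
    fix n :: nat and f :: "nat set \<Rightarrow> real" and x :: "nat \<Rightarrow> real"
    assume "\<forall>S\<in>Pow {1..n}. f S \<ge> 0" "mono_on (Pow {1..n}) f" "submodular_on {1..n} f"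
      "\<forall>i\<in>{1..n}. x i \<in> {0..1}" and pos: "pairwise_extension {1..n} f x > 0"
    then have "(1 - exp (-1)) * concave_closure {1..n} f x \<le> pairwise_extension {1..n} f x"
      by (intro concave_closure_le_pairwise_extension) auto
    moreover have "0 < 1 - exp (-1 :: real)"
      by simp
    ultimately show "concave_closure {1..n} f x / pairwise_extension {1..n} f x \<le> exp 1 / (exp 1 - 1)"
      unfolding e using pos by (simp add: divide_le_eq le_divide_eq mult.commute)
  next
    fix m :: "nat \<Rightarrow> nat" and A :: "nat \<Rightarrow> nat \<Rightarrow> nat set"
    assume m: "\<forall>n\<ge>1. 1 \<le> m n \<and> m n \<le> n" "filterlim m at_top sequentially"
      "(\<lambda>n. real (m n)) \<in> o(\<lambda>n. real n)" and A: "\<forall>n\<ge>1. block_partition n (m n) (A n)"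
    have "(\<lambda>n. 1 / real (m n)) \<longlonglongrightarrow> 0"
      using filterlim_compose[OF lim_1_over_n m(2)] .
    moreover have "(\<lambda>n. real (m n) / real n) \<longlonglongrightarrow> 0"
      using smalloD_tendsto[OF m(3)] .
    ultimately have "(\<lambda>n. 1 / (1 - exp (-1) + (2 * (real (m n) / real n) + 1 / real (m n)) / 2))
        \<longlonglongrightarrow> 1 / (1 - exp (-1) + (2 * 0 + 0) / 2)"
      by (intro tendsto_intros) auto
    then have "(\<lambda>n. 1 / (1 - exp (-1) + (2 * real (m n) / real n + 1 / real (m n)) / 2))
        \<longlonglongrightarrow> 1 / (1 - exp (-1))"
      by simp
    then show "(\<lambda>n. concave_closure {1..n} (transversal_coverage (m n) (A n)) (\<lambda>i. 1 / real (m n)) /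
            pairwise_extension {1..n} (transversal_coverage (m n) (A n)) (\<lambda>i. 1 / real (m n)))
        \<longlonglongrightarrow> exp 1 / (exp 1 - 1)"
      unfolding e
    \<comment> \<open>The upper bound is the constant limit itself, so only the lower bound has to
      converge. Both hold eventually, since the assumptions on \<open>m n\<close> and
      \<open>A n\<close> start at \<open>n = 1\<close>.\<close>
    proof (rule tendsto_sandwich[OF _ _ _ tendsto_const, rotated 2])
      show "\<forall>\<^sub>F n in sequentially. 1 / (1 - exp (-1) + (2 * real (m n) / real n + 1 / real (m n)) / 2) \<le>
          concave_closure {1..n} (transversal_coverage (m n) (A n)) (\<lambda>i. 1 / real (m n)) /
          pairwise_extension {1..n} (transversal_coverage (m n) (A n)) (\<lambda>i. 1 / real (m n))"
        using eventually_ge_at_top[of "1 :: nat"]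
        by eventually_elim (use m(1) A in \<open>blast intro: transversal_coverage_ratio_bounds(2)\<close>)
      show "\<forall>\<^sub>F n in sequentially.
          concave_closure {1..n} (transversal_coverage (m n) (A n)) (\<lambda>i. 1 / real (m n)) /
          pairwise_extension {1..n} (transversal_coverage (m n) (A n)) (\<lambda>i. 1 / real (m n)) \<le>
          1 / (1 - exp (-1))"
        using eventually_ge_at_top[of "1 :: nat"]
        by eventually_elim (use m(1) A in \<open>blast intro: transversal_coverage_ratio_bounds(1)\<close>)
    qed
  }
qed

end
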